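(* If $Q=(q_n)_{n=1}^\infty$ is a dynamically generated basic sequence, then $\mathcal{RN}(Q)=\mathcal{N}(Q)$.
   Context: Notation: $\mathbb{N}=\{1,2,\dots\}$, $\mathbb{N}_0=\mathbb{N}\cup\{0\}$, $\mathbb{N}_{\ge 2}=\{2,3,\dots\}$. A basic sequence is a sequence $Q=(q_n)_{n=1}^\infty$ with $q_n\in\mathbb{N}_{\ge 2}$. Every $z\in[0,1)$ has a unique expansion $z=\sum_{n\ge1}\frac{z_n}{q_1\cdots q_n}$ with $z_n\in\{0,\dots,q_n-1\}$ and $z_n\ne q_n-1$ for infinitely many $n$. A continuous measure preserving system $(X,\mathscr{B},\mu,T)$ consists of a complete separable metric space $X$, its Borel $\sigma$-algebra $\mathscr{B}$, a probability measure $\mu$ on $\mathscr{B}$ giving positive measure to every nonempty open set, and a continuous $\mu$-preserving map $T:X\to X$. A point $x\in X$ is generic if $\frac1N\sum_{n=1}^N h(T^nx)\to\int_X h\,d\mu$ for every continuous $h:X\to\mathbb{C}$ with $h\in L^1(X,\mu)$. A continuous $f:X\to\mathbb{N}_{\ge2}$ (discrete target) generates the topology of $X$ if the topology of $X$ is the smallest topology $\tau$ on $X$ for which $f$ is continuous and $T^{-1}U\in\tau$ for all $U\in\tau$. $Q$ is dynamically generated if there exist a continuous measure preserving system $(X,\mathscr{B},\mu,T)$, a continuous $f:X\to\mathbb{N}_{\ge2}$ generating the topology of $X$, and a generic point $x\in X$ with $q_n=f(T^nx)$ for all $n\ge1$. For $D=(d_1,\dots,d_\ell)\in\mathbb{N}_0^\ell$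 let $\mathcal{I}_{Q,j}(D)=1$ if $d_i<q_{j+i-1}$ for all $1\le i\le\ell$ and $0$ otherwise, $Q_n(D)=\sum_{j=1}^n\frac{\mathcal{I}_{Q,j}(D)}{q_jq_{j+1}\cdots q_{j+\ell-1}}$, and $N_n^Q(D,z)=\#\{1\le i\le n: z_{i+j}=d_j\ \forall\,1\le j\le\ell\}$. $\mathcal{N}(Q)$ is the set of $z\in[0,1)$ with $\lim_n N_n^Q(D,z)/Q_n(D)=1$ for every block $D$ (of any length) with $\lim_nQ_n(D)=\infty$. $\mathcal{RN}(Q)$ is the set of $z\in[0,1)$ such that for every $\ell\in\mathbb{N}$ and all $D_1,D_2\in\mathbb{N}_0^\ell$ with $\lim_n\min(Q_n(D_1),Q_n(D_2))=\infty$ we have $$\lim_{n\to\infty}\frac{N_n^Q(D_1,z)/Q_n(D_1)}{N_n^Q(D_2,z)/Q_n(D_2)}=1.$$ *)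

theory Defs
  imports "HOL-Analysis.Analysis" "HOL-Probability.Probability_Measure"
begin

text \<open>
  Sequences indexed by \<open>n \<ge> 1\<close> are functions on \<^typ>\<open>nat\<close> whose value at \<open>0\<close> is never used.
  Blocks are nonempty lists, so the \<open>i\<close>-th digit of a block \<open>D\<close> (counting from \<open>1\<close>) is
  \<open>D ! (i - 1)\<close>.
\<close>

definition basic_sequence :: "(nat \<Rightarrow> nat) \<Rightarrow> bool" where
  "basic_sequence Q \<longleftrightarrow> (\<forall>n\<ge>1. Q n \<ge> 2)"


subsection \<open>Cantor series expansions\<close>

text \<open>The condition \<open>d 0 = 0\<close> only fixes the unused value, so that expansions are unique as functions.\<close>

definition cantor_expansion :: "(nat \<Rightarrow> nat) \<Rightarrow> real \<Rightarrow> (nat \<Rightarrow> nat) \<Rightarrow> bool" where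
  "cantor_expansion Q z d \<longleftrightarrow>
     d 0 = 0 \<and>
     (\<forall>n\<ge>1. d n < Q n) \<and>
     (\<exists>\<^sub>\<infinity>n. d n \<noteq> Q n - 1) \<and>
     (\<lambda>n. real (d (Suc n)) / (\<Prod>i=1..Suc n. real (Q i))) sums z"

definition cantor_digit :: "(nat \<Rightarrow> nat) \<Rightarrow> real \<Rightarrow> nat \<Rightarrow> nat" where
  "cantor_digit Q z = (THE d. cantor_expansion Q z d)"


subsection \<open>Dynamically generated sequences\<close>

definition continuous_mps :: "'a metric \<Rightarrow> 'a measure \<Rightarrow> ('a \<Rightarrow> 'a) \<Rightarrow> bool" where
  "continuous_mps X \<mu> T \<longleftrightarrow>
     mcomplete_of X \<and> separable_space (mtopology_of X) \<and>
     prob_space \<mu> \<and>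
     space \<mu> = mspace X \<and>
     sets \<mu> = sigma_sets (mspace X) {U. openin (mtopology_of X) U} \<and>
     (\<forall>U. openin (mtopology_of X) U \<and> U \<noteq> {} \<longrightarrow> measure \<mu> U > 0) \<and>
     continuous_map (mtopology_of X) (mtopology_of X) T \<and>
     (\<forall>A\<in>sets \<mu>. measure \<mu> (T -` A \<inter> space \<mu>) = measure \<mu> A)"

definition generic_point :: "'a metric \<Rightarrow> 'a measure \<Rightarrow> ('a \<Rightarrow> 'a) \<Rightarrow> 'a \<Rightarrow> bool" where
  "generic_point X \<mu> T x \<longleftrightarrow>
     x \<in> mspace X \<and>
     (\<forall>h :: 'a \<Rightarrow> complex.
        continuous_map (mtopology_of X) euclidean h \<and> integrable \<mu> h \<longrightarrow>
        (\<lambda>N. (\<Sum>n=1..N. h ((T ^^ n) x)) / of_nat N) \<longlonglongrightarrow> (LINT y|\<mu>. h y))"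

definition invariant_topology_for ::
    "'a set \<Rightarrow> ('a \<Rightarrow> 'a) \<Rightarrow> ('a \<Rightarrow> nat) \<Rightarrow> 'a topology \<Rightarrow> bool" where
  "invariant_topology_for S T f \<tau> \<longleftrightarrow>
     topspace \<tau> = S \<and>
     continuous_map \<tau> (discrete_topology {2..}) f \<and>
     (\<forall>U. openin \<tau> U \<longrightarrow> openin \<tau> (T -` U \<inter> S))"

definition generates_topology :: "'a metric \<Rightarrow> ('a \<Rightarrow> 'a) \<Rightarrow> ('a \<Rightarrow> nat) \<Rightarrow> bool" where
  "generates_topology X T f \<longleftrightarrow>
     invariant_topology_for (mspace X) T f (mtopology_of X) \<and>
     (\<forall>\<tau>. invariant_topology_for (mspace X) T f \<tau> \<longrightarrow>
          (\<forall>U. openin (mtopology_of X) U \<longrightarrow> openin \<tau> U))"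

text \<open>
  HOL cannot quantify existentially over types, so the type \<open>'a\<close> containing the points of the space
  is a parameter; the space itself is an arbitrary subset of \<open>'a\<close> with an arbitrary metric.  A result
  that assumes this predicate for a type variable \<open>'a\<close> covers systems on all spaces.
\<close>

definition dynamically_generated :: "'a itself \<Rightarrow> (nat \<Rightarrow> nat) \<Rightarrow> bool" where
  "dynamically_generated _ Q \<longleftrightarrow>
     (\<exists>(X :: 'a metric) \<mu> T f x.
        continuous_mps X \<mu> T \<and>
        continuous_map (mtopology_of X) (discrete_topology {2..}) f \<and>
        generates_topology X T f \<and>
        generic_point X \<mu> T x \<and>
        (\<forall>n\<ge>1. Q n = f ((T ^^ n) x)))"


subsection \<open>Normality and ratio normality\<close>

definition block_fits :: "(nat \<Rightarrow> nat) \<Rightarrow> nat \<Rightarrow> nat list \<Rightarrow> real" where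
  "block_fits Q j D = (if \<forall>i\<in>{1..length D}. D ! (i - 1) < Q (j + i - 1) then 1 else 0)"

definition expected_count :: "(nat \<Rightarrow> nat) \<Rightarrow> nat \<Rightarrow> nat list \<Rightarrow> real" where
  "expected_count Q n D =
     (\<Sum>j=1..n. block_fits Q j D / (\<Prod>i=1..length D. real (Q (j + i - 1))))"

definition block_count :: "(nat \<Rightarrow> nat) \<Rightarrow> nat \<Rightarrow> nat list \<Rightarrow> real \<Rightarrow> nat" where
  "block_count Q n D z =
     card {i\<in>{1..n}. \<forall>j\<in>{1..length D}. cantor_digit Q z (i + j) = D ! (j - 1)}"

definition normal_numbers :: "(nat \<Rightarrow> nat) \<Rightarrow> real set" where
  "normal_numbers Q =
     {z\<in>{0..<1}. \<forall>D. D \<noteq> [] \<and> filterlim (\<lambda>n. expected_count Q n D) at_top sequentially \<longrightarrow>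
        (\<lambda>n. real (block_count Q n D z) / expected_count Q n D) \<longlonglongrightarrow> 1}"

text \<open>
  Since block counts are monotone in \<open>n\<close>, the outer denominator below is either nonzero from some
  point on or always \<open>0\<close>; in the latter case the quotient is constantly \<open>0\<close> in HOL and \<open>z\<close> is not
  ratio normal, in agreement with the quotient being undefined.
\<close>

definition ratio_normal_numbers :: "(nat \<Rightarrow> nat) \<Rightarrow> real set" where
  "ratio_normal_numbers Q =
     {z\<in>{0..<1}. \<forall>l\<ge>1. \<forall>D1 D2. length D1 = l \<and> length D2 = l \<and>
        filterlim (\<lambda>n. min (expected_count Q n D1) (expected_count Q n D2)) at_top sequentially \<longrightarrow>
        (\<lambda>n. (real (block_count Q n D1 z) / expected_count Q n D1) /
             (real (block_count Q n D2 z) / expected_count Q n D2)) \<longlonglongrightarrow> 1}"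

end

theory Submission
  imports Defs
begin

text \<open>
  Fix a block length \<open>l\<close> and a block \<open>D\<^sub>0\<close> of that length with
  \<open>Q\<^sub>n(D\<^sub>0) \<rightarrow> \<infinity>\<close>.  By genericity and full support, every block \<open>D\<close> either fits
  nowhere in \<open>Q\<close> or satisfies \<open>Q\<^sub>n(D) \<rightarrow> \<infinity>\<close>; in both cases ratio normality gives
  \<open>N\<^sub>n(D)/n \<cdot> b\<^sub>n - Q\<^sub>n(D)/n \<rightarrow> 0\<close>, where \<open>b\<^sub>n = Q\<^sub>n(D\<^sub>0)/N\<^sub>n(D\<^sub>0)\<close>.  Summed over the
  finitely many \<open>D\<close> with entries below \<open>M\<close>, both \<open>N\<^sub>n(D)/n\<close> and \<open>Q\<^sub>n(D)/n\<close> eventually lie in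
  \<open>[1 - \<epsilon>, 1]\<close>: no mass escapes to large digits, because a digit is smaller than the
  corresponding term of \<open>Q\<close> and, by genericity applied to the clopen sets
  \<open>{f \<circ> T\<^sup>i \<le> M for all i \<le> l}\<close>, most windows of \<open>Q\<close> are bounded by a suitable \<open>M\<close>.
  Hence \<open>b\<^sub>n \<rightarrow> 1\<close>.
\<close>

section \<open>Cantor series expansions\<close>

context
  fixes Q :: "nat \<Rightarrow> nat"
begin

text \<open>Horner's scheme: the numerator of the n-th partial sum over the common denominator
  \<open>q_1 ... q_n\<close>.\<close>

primrec cantor_numerator :: "(nat \<Rightarrow> nat) \<Rightarrow> nat \<Rightarrow> nat" where
  "cantor_numerator d 0 = 0"
| "cantor_numerator d (Suc n) = Q (Suc n) * cantor_numerator d n + d (Suc n)"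

definition cantor_denominator :: "nat \<Rightarrow> real" where
  "cantor_denominator n = (\<Prod>i=1..n. real (Q i))"

section \<open>Growth of the denominators, and partial sums as fractions\<close>

lemma cantor_denominator_simps [simp]:
  "cantor_denominator 0 = 1"
  "cantor_denominator (Suc n) = real (Q (Suc n)) * cantor_denominator n"
  by (simp_all add: cantor_denominator_def mult.commute)

context
  assumes Q: "basic_sequence Q"
begin

lemma basic_sequence_Suc_ge_2: "Q (Suc n) \<ge> 2"
  using Q by (simp add: basic_sequence_def)

lemma cantor_denominator_ge: "cantor_denominator n \<ge> 2 ^ n"
proof (induction n)
  case (Suc n)
  have "real (Q (Suc n)) \<ge> 2"
    using basic_sequence_Suc_ge_2[of n] by linarith
  then show ?case
    using mult_mono[OF _ Suc, of 2 "real (Q (Suc n))"] by simp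
qed simp

lemma cantor_denominator_pos: "cantor_denominator n > 0"
  using cantor_denominator_ge[of n] by (meson less_le_trans zero_less_numeral zero_less_power)

lemma inverse_cantor_denominator_tendsto_0: "(\<lambda>n. 1 / cantor_denominator n) \<longlonglongrightarrow> 0"
proof (rule tendsto_sandwich[of "\<lambda>_. 0" _ _ "\<lambda>n. (1 / 2) ^ n"])
  show "\<forall>\<^sub>F n in sequentially. 1 / cantor_denominator n \<le> (1 / 2) ^ n"
    using cantor_denominator_ge cantor_denominator_pos
    by (intro always_eventually) (auto simp: power_one_over intro!: divide_left_mono)
qed (auto simp: cantor_denominator_pos less_imp_le intro!: LIMSEQ_realpow_zero)

lemma cantor_partial_sum:
  "(\<Sum>i<n. real (d (Suc i)) / (\<Prod>j=1..Suc i. real (Q j))) =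
     real (cantor_numerator d n) / cantor_denominator n"
proof (induction n)
  case (Suc n)
  have "real (Q (Suc n)) > 0" "cantor_denominator n > 0"
    using basic_sequence_Suc_ge_2[of n] cantor_denominator_pos by auto
  then have "real (cantor_numerator d n) / cantor_denominator n
      + real (d (Suc n)) / cantor_denominator (Suc n)
      = real (cantor_numerator d (Suc n)) / cantor_denominator (Suc n)"
    by (simp add: field_simps)
  then show ?case
    by (simp only: sum.lessThan_Suc Suc cantor_denominator_def)
qed simp

text \<open>The fractions with numerators \<open>cantor_numerator d n\<close> increase to
  \<open>z\<close>, and those with numerator one larger decrease to \<open>z\<close>. The second
  bound is strict because some later digit is not maximal. Thus \<open>z\<close> alone determines
  all numerators.\<close>

lemma floor_cantor_expansion:
  assumes "cantor_expansion Q z d"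
  shows "\<lfloor>z * cantor_denominator n\<rfloor> = int (cantor_numerator d n)"
proof -
  let ?lo = "\<lambda>n. real (cantor_numerator d n) / cantor_denominator n"
  let ?hi = "\<lambda>n. (real (cantor_numerator d n) + 1) / cantor_denominator n"
  have lt: "d (Suc m) < Q (Suc m)" for m
    using assms by (simp add: cantor_expansion_def)
  have lim: "?lo \<longlonglongrightarrow> z"
    using assms unfolding cantor_expansion_def sums_def cantor_partial_sum by simp
  from tendsto_add[OF this inverse_cantor_denominator_tendsto_0]
  have lim': "?hi \<longlonglongrightarrow> z"
    by (simp add: add_divide_distrib)
  have pos: "real (Q (Suc m)) > 0" for m
    using basic_sequence_Suc_ge_2[of m] by auto
  have inc: "incseq ?lo"
    unfolding cantor_partial_sum[symmetric]
    by (rule incseq_SucI) (simp del: prod.cl_ivl_Suc add: prod_nonneg)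
  \<comment> \<open>The upper bound drops by an amount that vanishes exactly when the next digit is
    maximal.\<close>
  have hi_Suc: "?hi (Suc m) = ?hi m - (real (Q (Suc m)) - 1 - real (d (Suc m))) / cantor_denominator (Suc m)" for m
    using pos[of m] cantor_denominator_pos[of m] by (simp add: field_simps)
  have dec: "decseq ?hi"
  proof (rule decseq_SucI)
    fix m
    have "real (Q (Suc m)) - 1 - real (d (Suc m)) \<ge> 0"
      using lt[of m] by linarith
    then show "?hi (Suc m) \<le> ?hi m"
      unfolding hi_Suc using cantor_denominator_pos[of "Suc m"] by simp
  qed
  have "?lo n \<le> z"
    by (rule incseq_le[OF inc lim])
  moreover have "z < ?hi n"
  proof -
    have "\<exists>\<^sub>\<infinity>n. d n \<noteq> Q n - 1"
      using assms by (simp add: cantor_expansion_def)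
    then obtain m' where m': "m' > n" "d m' \<noteq> Q m' - 1"
      unfolding INFM_nat by blast
    then obtain m where m: "m' = Suc m" "n \<le> m"
      by (cases m') auto
    have "real (Q (Suc m)) - 1 - real (d (Suc m)) > 0"
      using lt[of m] m'(2) unfolding m(1) by linarith
    then have "?hi (Suc m) < ?hi m"
      unfolding hi_Suc using cantor_denominator_pos[of "Suc m"] by simp
    also have "?hi m \<le> ?hi n"
      using dec m by (simp add: decseq_def)
    finally show ?thesis
      using decseq_ge[OF dec lim', of "Suc m"] by linarith
  qed
  ultimately show ?thesis
    using cantor_denominator_pos[of n] by (intro floor_unique) (simp_all add: field_simps)
qed

text \<open>Each digit is recovered from two consecutive numerators, and these are floors that
  depend only on \<open>z\<close>.\<close>

lemma cantor_expansion_unique: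
  assumes "cantor_expansion Q z d" "cantor_expansion Q z e"
  shows "d = e"
proof
  have eq: "cantor_numerator d m = cantor_numerator e m" for m
    using floor_cantor_expansion[OF assms(1), of m] floor_cantor_expansion[OF assms(2), of m]
    by simp
  show "d n = e n" for n
  proof (cases n)
    case 0
    then show ?thesis
      using assms by (simp add: cantor_expansion_def)
  next
    case (Suc m)
    then show ?thesis
      using eq[of m] eq[of "Suc m"] by simp
  qed
qed

text \<open>The floor formula is used backwards: the floors \<open>k n\<close> of
  \<open>z * cantor_denominator n\<close> serve as numerators, and the digits are read off from the
  recursion.\<close>

lemma cantor_expansion_exists:
  assumes "z \<in> {0..<1}"
  shows "\<exists>d. cantor_expansion Q z d"
proof -
  define k where "k n = nat \<lfloor>z * cantor_denominator n\<rfloor>" for n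
  define d where "d n = (if n = 0 then 0 else k n - Q n * k (n - 1))" for n
  have k: "real (k n) \<le> z * cantor_denominator n" "z * cantor_denominator n < real (k n) + 1" for n
  proof -
    have "z * cantor_denominator n \<ge> 0"
      using assms cantor_denominator_pos[of n] by simp
    then show "real (k n) \<le> z * cantor_denominator n" "z * cantor_denominator n < real (k n) + 1"
      unfolding k_def by linarith+
  qed
  \<comment> \<open>The second bound makes the truncated subtraction in \<open>d\<close> exact; the
    first gives \<open>d n < Q n\<close>.\<close>
  have k_Suc: "k (Suc n) < Q (Suc n) * (k n + 1)" "Q (Suc n) * k n \<le> k (Suc n)" for n
  proof -
    have "real (Q (Suc n)) > 0"
      using basic_sequence_Suc_ge_2[of n] by auto
    then have *: "real (Q (Suc n)) * real (k n) \<le> z * cantor_denominator (Suc n)"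
      "z * cantor_denominator (Suc n) < real (Q (Suc n)) * (real (k n) + 1)"
      using mult_left_mono[OF k(1)[of n], of "real (Q (Suc n))"]
        mult_strict_left_mono[OF k(2)[of n], of "real (Q (Suc n))"]
      by (simp_all add: ac_simps)
    have "real (k (Suc n)) < real (Q (Suc n) * (k n + 1))"
      using * k(1)[of "Suc n"] by (simp add: algebra_simps)
    then show "k (Suc n) < Q (Suc n) * (k n + 1)"
      by (simp only: of_nat_less_iff)
    have "real (Q (Suc n) * k n) < real (k (Suc n) + 1)"
      using * k(2)[of "Suc n"] by (simp add: algebra_simps)
    then show "Q (Suc n) * k n \<le> k (Suc n)"
      by (simp only: of_nat_less_iff)
  qed
  have num: "cantor_numerator d n = k n" for n
  proof (induction n)
    case 0
    show ?case
      using assms by (simp add: k_def floor_eq_iff)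
  next
    case (Suc n)
    then show ?case
      using k_Suc(2)[of n] by (simp add: d_def)
  qed
  have "(\<lambda>n. real (k n) / cantor_denominator n) \<longlonglongrightarrow> z"
  proof (rule tendsto_sandwich[of "\<lambda>n. z - 1 / cantor_denominator n" _ _ "\<lambda>_. z"])
    show "(\<lambda>n. z - 1 / cantor_denominator n) \<longlonglongrightarrow> z"
      using tendsto_diff[OF tendsto_const inverse_cantor_denominator_tendsto_0, of z] by simp
    show "\<forall>\<^sub>F n in sequentially. z - 1 / cantor_denominator n \<le> real (k n) / cantor_denominator n"
    proof (intro always_eventually allI)
      show "z - 1 / cantor_denominator n \<le> real (k n) / cantor_denominator n" for n
      proof -
        have "z < (real (k n) + 1) / cantor_denominator n"
          using k(2)[of n] cantor_denominator_pos[of n] by (simp add: pos_less_divide_eq)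
        then show ?thesis
          by (simp add: add_divide_distrib)
      qed
    qed
    show "\<forall>\<^sub>F n in sequentially. real (k n) / cantor_denominator n \<le> z"
      using k(1) cantor_denominator_pos by (intro always_eventually) (simp add: field_simps)
  qed simp
  then have lim: "(\<lambda>n. real (d (Suc n)) / (\<Prod>i=1..Suc n. real (Q i))) sums z"
    unfolding sums_def cantor_partial_sum num .
  have lt: "d (Suc n) < Q (Suc n)" for n
    using k_Suc[of n] by (simp add: d_def algebra_simps)
  have "\<exists>\<^sub>\<infinity>n. d n \<noteq> Q n - 1"
  proof (rule ccontr)
    assume "\<not> ?thesis"
    then obtain N where N: "\<And>n. n > N \<Longrightarrow> d n = Q n - 1"
      unfolding INFM_nat by blast
    let ?hi = "\<lambda>n. (real (k n) + 1) / cantor_denominator n"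
    \<comment> \<open>If all digits after \<open>N\<close> were maximal, the upper bounds
      \<open>?hi\<close> would be constant from \<open>N\<close> on and hence equal to their limit
      \<open>z\<close>, but \<open>z\<close> lies strictly below \<open>?hi N\<close>.\<close>
    have const: "?hi (N + m) = ?hi N" for m
    proof (induction m)
      case (Suc m)
      have "k (Suc (N + m)) = Q (Suc (N + m)) * k (N + m) + d (Suc (N + m))"
        using num[of "Suc (N + m)"] num[of "N + m"] by simp
      then have "k (Suc (N + m)) + 1 = Q (Suc (N + m)) * (k (N + m) + 1)"
        using N[of "Suc (N + m)"] basic_sequence_Suc_ge_2[of "N + m"] by simp
      then have "real (k (Suc (N + m))) + 1 = real (Q (Suc (N + m))) * (real (k (N + m)) + 1)"
        by (metis of_nat_1 of_nat_add of_nat_mult)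
      then have "?hi (Suc (N + m)) = ?hi (N + m)"
        using basic_sequence_Suc_ge_2[of "N + m"] cantor_denominator_pos[of "N + m"] by simp
      then show ?case
        using Suc by simp
    qed simp
    have "(\<lambda>n. real (k n) / cantor_denominator n) \<longlonglongrightarrow> z" by fact
    from tendsto_add[OF this inverse_cantor_denominator_tendsto_0]
    have "?hi \<longlonglongrightarrow> z"
      by (simp add: add_divide_distrib)
    then have "(\<lambda>m. ?hi (m + N)) \<longlonglongrightarrow> z"
      by (rule LIMSEQ_ignore_initial_segment)
    then have "z = ?hi N"
      using const by (simp add: add.commute LIMSEQ_const_iff)
    then show False
      using k(2)[of N] cantor_denominator_pos[of N] by (simp add: field_simps)
  qed
  moreover have "d n < Q n" if "n \<ge> 1" for n
    using that lt by (cases n) auto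
  ultimately have "cantor_expansion Q z d"
    using lim unfolding cantor_expansion_def by (auto simp: d_def)
  then show ?thesis
    by blast
qed

text \<open>Existence and uniqueness make the description operator in \<open>cantor_digit\<close>
  pick the expansion. This bound is what the counting arguments take from it.\<close>

lemma cantor_digit_less:
  assumes "z \<in> {0..<1}" "n \<ge> 1"
  shows "cantor_digit Q z n < Q n"
proof -
  have "\<exists>!d. cantor_expansion Q z d"
    using cantor_expansion_exists[OF assms(1)] cantor_expansion_unique by blast
  then have "cantor_expansion Q z (cantor_digit Q z)"
    unfolding cantor_digit_def by (rule theI')
  then show ?thesis
    using assms(2) by (simp add: cantor_expansion_def)
qed

end

end

section \<open>Generic averages of window functions\<close>

lemma continuous_mps_funpow_in_mspace:
  assumes "continuous_mps X \<mu> T" "y \<in> mspace X"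
  shows "(T ^^ i) y \<in> mspace X"
  using assms by (induction i) (auto simp: continuous_mps_def continuous_map_def)

lemma continuous_map_funpow_mps:
  assumes "continuous_mps X \<mu> T"
  shows "continuous_map (mtopology_of X) (mtopology_of X) (T ^^ i)"
proof (induction i)
  case (Suc i)
  show ?case
    unfolding funpow.simps
    by (rule continuous_map_compose[OF Suc]) (use assms in \<open>simp add: continuous_mps_def\<close>)
qed (simp add: id_def)

text \<open>The window functions are locally constant, so preimages under them are open whatever the target.\<close>

lemma openin_window_vimage:
  fixes f :: "'a \<Rightarrow> nat"
  assumes mps: "continuous_mps X \<mu> T"
    and f: "continuous_map (mtopology_of X) (discrete_topology {2..}) f"
  shows "openin (mtopology_of X) {y \<in> mspace X. P (map (\<lambda>i. f ((T ^^ i) y)) [0..<k])}"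
proof -
  let ?W = "\<lambda>y. map (\<lambda>i. f ((T ^^ i) y)) [0..<k]"
  have cont: "continuous_map (mtopology_of X) (discrete_topology {2..}) (\<lambda>y. f ((T ^^ i) y))" for i
    using continuous_map_compose[OF continuous_map_funpow_mps[OF mps] f] by (simp add: o_def)
  have level: "openin (mtopology_of X) {y \<in> mspace X. f ((T ^^ i) y) = b}" for i b
  proof -
    \<comment> \<open>Open sets of the target are the subsets of \<open>{2..}\<close>, so the point
      \<open>b\<close> is intersected with it; for \<open>b < 2\<close> the level set is
      empty.\<close>
    have "openin (mtopology_of X) {y \<in> mspace X. f ((T ^^ i) y) \<in> {b} \<inter> {2..}}"
      using openin_continuous_map_preimage[OF cont, of "{b} \<inter> {2..}"] by simp
    also have "{y \<in> mspace X. f ((T ^^ i) y) \<in> {b} \<inter> {2..}} = {y \<in> mspace X. f ((T ^^ i) y) = b}"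
      using continuous_map_image_subset_topspace[OF cont] by auto
    finally show ?thesis .
  qed
  have fibre: "openin (mtopology_of X) {y \<in> mspace X. ?W y = ws}" for ws
  proof (cases "length ws = k")
    case True
    have "openin (mtopology_of X) {y \<in> mspace X. \<forall>i<n. f ((T ^^ i) y) = ws ! i}" for n
    proof (induction n)
      case 0
      show ?case
        using openin_topspace[of "mtopology_of X"] by simp
    next
      case (Suc n)
      have "{y \<in> mspace X. \<forall>i<Suc n. f ((T ^^ i) y) = ws ! i} =
          {y \<in> mspace X. \<forall>i<n. f ((T ^^ i) y) = ws ! i} \<inter> {y \<in> mspace X. f ((T ^^ n) y) = ws ! n}"
        by (auto simp: less_Suc_eq)
      then show ?case
        using openin_Int[OF Suc level] by simp
    qed
    moreover have "{y \<in> mspace X. ?W y = ws} = {y \<in> mspace X. \<forall>i<k. f ((T ^^ i) y) = ws ! i}"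
      using True by (auto simp: list_eq_iff_nth_eq)
    ultimately show ?thesis
      by simp
  next
    case False
    then have "{y \<in> mspace X. ?W y = ws} = {}"
      by auto
    then show ?thesis
      by (simp only: openin_empty)
  qed
  \<comment> \<open>Any condition on the window is a union of fibres, so an arbitrary
    \<open>P\<close> is allowed.\<close>
  have "{y \<in> mspace X. P (?W y)} = (\<Union>ws\<in>Collect P. {y \<in> mspace X. ?W y = ws})"
    by auto
  moreover have "openin (mtopology_of X) \<dots>"
    using fibre by blast
  ultimately show ?thesis
    by simp
qed

text \<open>A window of \<open>Q\<close> at position \<open>j\<close> depends only on the point
  \<open>T^j x\<close> of the orbit. Keeping it as a list lets one lemma handle every function of
  finitely many consecutive terms.\<close>

definition window :: "(nat \<Rightarrow> nat) \<Rightarrow> nat \<Rightarrow> nat \<Rightarrow> nat list" where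
  "window Q k j = map (\<lambda>i. Q (j + i)) [0..<k]"

text \<open>Window functions are continuous because they are locally constant, and bounded ones are
  integrable for a probability measure. They are therefore admissible test functions for a generic
  point.\<close>

lemma
  fixes f :: "'a \<Rightarrow> nat" and \<phi> :: "nat list \<Rightarrow> real"
  assumes mps: "continuous_mps X \<mu> T"
    and f: "continuous_map (mtopology_of X) (discrete_topology {2..}) f"
    and bounded: "\<And>ws. \<bar>\<phi> ws\<bar> \<le> B"
  shows integrable_window_function: "integrable \<mu> (\<lambda>y. \<phi> (map (\<lambda>i. f ((T ^^ i) y)) [0..<k]))"
    and generic_window_average: "generic_point X \<mu> T x \<Longrightarrow>
      (\<lambda>N. (\<Sum>n=1..N. \<phi> (window (\<lambda>n. f ((T ^^ n) x)) k n)) / real N)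
        \<longlonglongrightarrow> (LINT y|\<mu>. \<phi> (map (\<lambda>i. f ((T ^^ i) y)) [0..<k]))"
proof -
  let ?W = "\<lambda>y. map (\<lambda>i. f ((T ^^ i) y)) [0..<k]"
  have sets: "sets \<mu> = sigma_sets (mspace X) {U. openin (mtopology_of X) U}"
    and space: "space \<mu> = mspace X" and "prob_space \<mu>"
    using mps by (auto simp: continuous_mps_def)
  interpret prob_space \<mu> by fact
  have meas: "(\<lambda>y. \<phi> (?W y)) \<in> borel_measurable \<mu>"
  proof (rule measurableI)
    fix A :: "real set"
    have "(\<lambda>y. \<phi> (?W y)) -` A \<inter> space \<mu> = {y \<in> mspace X. \<phi> (?W y) \<in> A}"
      by (auto simp: space)
    then show "(\<lambda>y. \<phi> (?W y)) -` A \<inter> space \<mu> \<in> sets \<mu>"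
      using openin_window_vimage[OF mps f, of "\<lambda>ws. \<phi> ws \<in> A"] unfolding sets
      by auto
  qed simp
  show int: "integrable \<mu> (\<lambda>y. \<phi> (?W y))"
    by (rule integrable_const_bound[of _ B]) (use bounded meas in auto)
  assume gen: "generic_point X \<mu> T x"
  \<comment> \<open>Genericity is stated for complex test functions, so the real function is
    embedded and the limit pulled back at the end.\<close>
  let ?h = "\<lambda>y. complex_of_real (\<phi> (?W y))"
  have "continuous_map (mtopology_of X) euclidean ?h"
    unfolding continuous_map_def
  proof (intro conjI allI impI)
    show "openin (mtopology_of X) {y \<in> topspace (mtopology_of X). ?h y \<in> U}" for U
      using openin_window_vimage[OF mps f, of "\<lambda>ws. complex_of_real (\<phi> ws) \<in> U"] by simp
  qed simp
  then have "(\<lambda>N. (\<Sum>n=1..N. ?h ((T ^^ n) x)) / of_nat N) \<longlonglongrightarrow> (LINT y|\<mu>. ?h y)"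
    using gen int unfolding generic_point_def by auto
  moreover have "?W ((T ^^ n) x) = window (\<lambda>n. f ((T ^^ n) x)) k n" for n
    by (simp add: window_def add.commute[of n] funpow_add)
  ultimately have "(\<lambda>N. complex_of_real ((\<Sum>n=1..N. \<phi> (window (\<lambda>n. f ((T ^^ n) x)) k n)) / real N))
      \<longlonglongrightarrow> complex_of_real (LINT y|\<mu>. \<phi> (?W y))"
    by simp
  then show "(\<lambda>N. (\<Sum>n=1..N. \<phi> (window (\<lambda>n. f ((T ^^ n) x)) k n)) / real N)
        \<longlonglongrightarrow> (LINT y|\<mu>. \<phi> (?W y))"
    by (simp only: tendsto_of_real_iff)
qed

lemma window_cong: "(\<And>i. i < k \<Longrightarrow> Q (j + i) = R (j + i)) \<Longrightarrow> window Q k j = window R k j"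
  by (simp add: window_def)

text \<open>
  Full support enters here: a nonnegative window function with vanishing integral vanishes
  everywhere, as its support is open.
\<close>

lemma dynamically_generated_window_dichotomy:
  fixes \<phi> :: "nat list \<Rightarrow> real"
  assumes "dynamically_generated TYPE('a) Q"
    and nonneg: "\<And>ws. \<phi> ws \<ge> 0" and bound: "\<And>ws. \<phi> ws \<le> B"
  shows "filterlim (\<lambda>n. \<Sum>j=1..n. \<phi> (window Q k j)) at_top sequentially \<or>
    (\<forall>j\<ge>1. \<phi> (window Q k j) = 0)"
proof -
  from assms(1) obtain X :: "'a metric" and \<mu> T f x
    where mps: "continuous_mps X \<mu> T"
      and f: "continuous_map (mtopology_of X) (discrete_topology {2..}) f"
      and gen: "generic_point X \<mu> T x"
      and Q: "\<And>n. n \<ge> 1 \<Longrightarrow> Q n = f ((T ^^ n) x)"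
    unfolding dynamically_generated_def by blast
  let ?W = "\<lambda>y. map (\<lambda>i. f ((T ^^ i) y)) [0..<k]"
  let ?c = "LINT y|\<mu>. \<phi> (?W y)"
  \<comment> \<open>The value \<open>Q 0\<close> is unrelated to the orbit, so windows agree only
    from position 1 on.\<close>
  have window: "window Q k j = window (\<lambda>n. f ((T ^^ n) x)) k j" if "j \<ge> 1" for j
    using that by (intro window_cong Q) auto
  have bounded: "\<bar>\<phi> ws\<bar> \<le> B" for ws
    using nonneg[of ws] bound[of ws] by simp
  have lim: "(\<lambda>n. (\<Sum>j=1..n. \<phi> (window Q k j)) / real n) \<longlonglongrightarrow> ?c"
    using generic_window_average[where \<phi> = \<phi> and k = k, OF mps f bounded gen]
    by (simp add: window)
  have int: "integrable \<mu> (\<lambda>y. \<phi> (?W y))"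
    by (rule integrable_window_function[OF mps f bounded])
  have "?c \<ge> 0"
    using nonneg by simp
  then consider "?c > 0" | "?c = 0"
    by fastforce
  then show ?thesis
  proof cases
    case 1
    \<comment> \<open>Averages with a positive limit force the sums to grow linearly.\<close>
    have "filterlim (\<lambda>n. (\<Sum>j=1..n. \<phi> (window Q k j)) / real n * real n) at_top sequentially"
      by (rule filterlim_tendsto_pos_mult_at_top[OF lim 1 filterlim_real_sequentially])
    moreover have "(\<Sum>j=1..n. \<phi> (window Q k j)) / real n * real n = (\<Sum>j=1..n. \<phi> (window Q k j))" for n
      by (cases n) auto
    ultimately show ?thesis
      by simp
  next
    case 2
    let ?U = "{y \<in> mspace X. \<phi> (?W y) \<noteq> 0}"
    have "openin (mtopology_of X) ?U"
      by (rule openin_window_vimage[OF mps f])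
    have space: "space \<mu> = mspace X"
      using mps by (simp add: continuous_mps_def)
    have "AE y in \<mu>. \<phi> (?W y) = 0"
      using 2 nonneg integral_nonneg_eq_0_iff_AE[OF int] by simp
    then have "AE y in \<mu>. y \<notin> ?U"
      by eventually_elim simp
    then have "measure \<mu> ?U = measure \<mu> {}"
      by (intro measure_eq_AE) (use \<open>openin _ ?U\<close> mps in
          \<open>auto simp: continuous_mps_def\<close>)
    then have "?U = {}"
      using mps \<open>openin _ ?U\<close> unfolding continuous_mps_def
      by (metis (no_types, lifting) less_irrefl measure_empty)
    moreover have "(T ^^ j) x \<in> mspace X" for j
      using continuous_mps_funpow_in_mspace[OF mps] gen by (simp add: generic_point_def)
    ultimately have "\<phi> (?W ((T ^^ j) x)) = 0" for j
      by blast
    moreover have "?W ((T ^^ j) x) = window (\<lambda>n. f ((T ^^ n) x)) k j" for j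
      by (simp add: window_def add.commute[of j] funpow_add)
    ultimately show ?thesis
      using window by simp
  qed
qed

text \<open>The sets of points whose window is bounded by \<open>M\<close> increase to the whole
  space, as each window is finite. Some \<open>M\<close> thus gives measure above
  \<open>1 - \<epsilon>\<close>, and genericity turns this measure into a frequency along
  \<open>Q\<close>.\<close>

lemma dynamically_generated_windows_bounded:
  assumes "dynamically_generated TYPE('a) Q" and "\<epsilon> > 0"
  shows "\<exists>M. \<forall>\<^sub>F n in sequentially. (1 - \<epsilon>) * real n \<le> real (card {j\<in>{1..n}. \<forall>i<k. Q (j + i) \<le> M})"
proof -
  from assms(1) obtain X :: "'a metric" and \<mu> T f x
    where mps: "continuous_mps X \<mu> T"
      and f: "continuous_map (mtopology_of X) (discrete_topology {2..}) f"
      and gen: "generic_point X \<mu> T x"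
      and Q: "\<And>n. n \<ge> 1 \<Longrightarrow> Q n = f ((T ^^ n) x)"
    unfolding dynamically_generated_def by blast
  have sets: "sets \<mu> = sigma_sets (mspace X) {U. openin (mtopology_of X) U}"
    and space: "space \<mu> = mspace X" and "prob_space \<mu>"
    using mps by (auto simp: continuous_mps_def)
  interpret prob_space \<mu> by fact
  let ?W = "\<lambda>y. map (\<lambda>i. f ((T ^^ i) y)) [0..<k]"
  let ?A = "\<lambda>M. {y \<in> mspace X. \<forall>w\<in>set (?W y). w \<le> M}"
  have A: "?A M \<in> sets \<mu>" for M
    using openin_window_vimage[OF mps f, of "\<lambda>ws. \<forall>w\<in>set ws. w \<le> M"] unfolding sets
    by auto
  have "(\<Union>M. ?A M) = space \<mu>"
  proof -
    have "\<exists>M. y \<in> ?A M" if "y \<in> mspace X" for y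
      using that Max_ge[of "set (?W y)"] by blast
    then show ?thesis
      by (auto simp: space)
  qed
  moreover have "(\<lambda>M. prob (?A M)) \<longlonglongrightarrow> prob (\<Union>M. ?A M)"
    by (rule finite_Lim_measure_incseq) (use A in \<open>auto simp: incseq_def intro: order_trans\<close>)
  ultimately have "(\<lambda>M. prob (?A M)) \<longlonglongrightarrow> 1"
    by (simp add: prob_space)
  then have "\<forall>\<^sub>F M in sequentially. prob (?A M) > 1 - \<epsilon>"
    using \<open>\<epsilon> > 0\<close> by (intro order_tendstoD) auto
  then obtain M where M: "prob (?A M) > 1 - \<epsilon>"
    by (auto simp: eventually_sequentially)
  \<comment> \<open>The indicator of \<open>?A M\<close> written as a window function, so that its
    orbit averages tend to \<open>prob (?A M)\<close>.\<close>
  let ?\<phi> = "\<lambda>ws. of_bool (\<forall>w\<in>set ws. w \<le> M) :: real"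
  have "(LINT y|\<mu>. ?\<phi> (?W y)) = (LINT y|\<mu>. indicator (?A M) y)"
    by (rule Bochner_Integration.integral_cong) (auto simp: space indicator_def)
  also have "\<dots> = prob (?A M)"
    using A by simp
  finally have "(\<lambda>N. (\<Sum>n=1..N. ?\<phi> (window (\<lambda>n. f ((T ^^ n) x)) k n)) / real N) \<longlonglongrightarrow> prob (?A M)"
    using generic_window_average[OF mps f _ gen, of ?\<phi> 1 k] by simp
  then have "\<forall>\<^sub>F N in sequentially. 1 - \<epsilon> < (\<Sum>n=1..N. ?\<phi> (window (\<lambda>n. f ((T ^^ n) x)) k n)) / real N"
    using M by (rule order_tendstoD)
  then have "\<forall>\<^sub>F N in sequentially. (1 - \<epsilon>) * real N \<le> real (card {j\<in>{1..N}. \<forall>i<k. Q (j + i) \<le> M})"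
    using eventually_gt_at_top[of 0]
  proof eventually_elim
    case (elim N)
    have "(\<Sum>n=1..N. ?\<phi> (window (\<lambda>n. f ((T ^^ n) x)) k n)) = (\<Sum>n=1..N. of_bool (\<forall>i<k. Q (n + i) \<le> M))"
      by (intro sum.cong) (auto simp: window_def Q)
    also have "\<dots> = real (card {j\<in>{1..N}. \<forall>i<k. Q (j + i) \<le> M})"
      by (simp add: of_bool_def sum.If_cases Int_def)
    finally show ?case
      using elim by (simp add: field_simps)
  qed
  then show ?thesis ..
qed

section \<open>Expected and actual block counts\<close>

lemma ball_atLeast1_atMost: "(\<forall>i\<in>{1..n}. P i) \<longleftrightarrow> (\<forall>i<n. P (Suc i))"
  unfolding image_Suc_lessThan[symmetric] by auto

text \<open>The summand of \<open>expected_count\<close> as a function of the window alone. For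
  positive entries \<open>ws\<close> it is, as a function of \<open>D\<close>, the uniform
  probability on the blocks lying entrywise below \<open>ws\<close>; blocks of another length get
  weight 0.\<close>

definition block_weight :: "nat list \<Rightarrow> nat list \<Rightarrow> real" where
  "block_weight D ws = of_bool (list_all2 (<) D ws) / real (prod_list ws)"

lemma block_weight_nonneg: "block_weight D ws \<ge> 0"
  by (simp add: block_weight_def)

text \<open>This form exhibits the expected count as a sum of a window function, to which the
  dichotomy applies.\<close>

lemma expected_count_eq: "expected_count Q n D = (\<Sum>j=1..n. block_weight D (window Q (length D) j))"
proof -
  have "block_fits Q j D = of_bool (list_all2 (<) D (window Q (length D) j))" for j
    unfolding block_fits_def ball_atLeast1_atMost
    by (simp add: list_all2_conv_all_nth window_def)
  moreover have "(\<Prod>i=1..length D. real (Q (j + i - 1))) = real (prod_list (window Q (length D) j))" for j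
  proof -
    have "(\<Prod>i=1..length D. Q (j + i - 1)) = (\<Prod>i<length D. Q (j + i))"
      by (simp add: prod.atLeast1_atMost_eq)
    also have "\<dots> = prod_list (window Q (length D) j)"
      unfolding window_def lessThan_atLeast0 atLeastLessThan_upt
      by (rule prod.distinct_set_conv_list) simp
    finally show ?thesis
      by (metis of_nat_prod)
  qed
  ultimately show ?thesis
    by (simp add: expected_count_def block_weight_def)
qed

lemma block_count_eq:
  "block_count Q n D z = card {i\<in>{1..n}. window (cantor_digit Q z) (length D) (Suc i) = D}"
proof -
  have "(\<forall>j\<in>{1..length D}. cantor_digit Q z (i + j) = D ! (j - 1)) \<longleftrightarrow>
      window (cantor_digit Q z) (length D) (Suc i) = D" for i
    unfolding ball_atLeast1_atMost list_eq_iff_nth_eq[of _ D] by (simp add: window_def)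
  then show ?thesis
    unfolding block_count_def by presburger
qed

text \<open>The first entry has \<open>w\<close> choices independently of the rest, so cardinalities
  multiply. This is why the weights of all blocks below a positive window add up to 1.\<close>

lemma blocks_below:
  "finite {D. list_all2 (<) D ws} \<and> card {D. list_all2 (<) D ws} = prod_list (ws :: nat list)"
proof (induction ws)
  case Nil
  show ?case
    by simp
next
  case (Cons w ws)
  have "{D. list_all2 (<) D (w # ws)} = (\<lambda>(d, D). d # D) ` ({..<w} \<times> {D. list_all2 (<) D ws})"
    by (auto simp: list_all2_Cons2 image_iff)
  moreover have "inj_on (\<lambda>(d, D). d # D) ({..<w} \<times> {D. list_all2 (<) D ws})"
    by (auto simp: inj_on_def)
  ultimately show ?case
    using Cons by (simp add: card_image card_cartesian_product)
qed

section \<open>Total weight of a finite family of blocks\<close>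

lemma sum_block_weight:
  assumes "finite F"
  shows "(\<Sum>D\<in>F. block_weight D ws) = real (card {D\<in>F. list_all2 (<) D ws}) / real (prod_list ws)"
  unfolding block_weight_def sum_divide_distrib[symmetric]
  using assms by (simp add: of_bool_def sum.If_cases Int_def)

lemma sum_block_weight_le_1:
  assumes "finite F"
  shows "(\<Sum>D\<in>F. block_weight D ws) \<le> 1"
proof -
  have "card {D\<in>F. list_all2 (<) D ws} \<le> prod_list ws"
    using card_mono[of "{D. list_all2 (<) D ws}" "{D\<in>F. list_all2 (<) D ws}"] blocks_below[of ws] by auto
  \<comment> \<open>If the product is 0, the quotient is 0 by the convention for division by
    zero.\<close>
  then show ?thesis
    unfolding sum_block_weight[OF assms] by (cases "prod_list ws = 0") (simp_all add: divide_le_eq_1)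
qed

lemma block_weight_le_1: "block_weight D ws \<le> 1"
  using sum_block_weight_le_1[of "{D}" ws] by simp

lemma finite_bounded_blocks: "finite {D. set D \<subseteq> {..<M :: nat} \<and> length D = l}"
  by (rule finite_lists_length_eq) simp

text \<open>Every block below a window bounded by \<open>M\<close> has entries less than
  \<open>M\<close>, so the finite family already carries the whole mass.\<close>

lemma sum_block_weight_eq_1:
  assumes "\<And>w. w \<in> set ws \<Longrightarrow> 0 < w \<and> w \<le> M"
  shows "(\<Sum>D | set D \<subseteq> {..<M} \<and> length D = length ws. block_weight D ws) = 1"
proof -
  have "set D \<subseteq> {..<M}" if "list_all2 (<) D ws" for D
    using that assms by (fastforce simp: list_all2_conv_all_nth in_set_conv_nth)
  then have "{D\<in>{D. set D \<subseteq> {..<M} \<and> length D = length ws}. list_all2 (<) D ws} = {D. list_all2 (<) D ws}"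
    by (auto dest: list_all2_lengthD)
  moreover have "prod_list ws \<noteq> 0"
    using assms by (auto simp: prod_list_zero_iff)
  ultimately show ?thesis
    using blocks_below[of ws] by (simp add: sum_block_weight[OF finite_bounded_blocks])
qed

section \<open>Total counts over all blocks with bounded entries\<close>

lemma sum_expected_count:
  assumes "\<And>D. D \<in> F \<Longrightarrow> length D = l"
  shows "(\<Sum>D\<in>F. expected_count Q n D) = (\<Sum>j=1..n. \<Sum>D\<in>F. block_weight D (window Q l j))"
  unfolding expected_count_eq by (subst sum.swap) (simp add: assms)

lemma sum_expected_count_le:
  assumes "finite F" "\<And>D. D \<in> F \<Longrightarrow> length D = l"
  shows "(\<Sum>D\<in>F. expected_count Q n D) \<le> real n"
  using sum_mono[of "{1..n}", OF sum_block_weight_le_1[OF assms(1)], of "\<lambda>j. window Q l j"]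
  by (simp add: sum_expected_count[OF assms(2)])

lemma expected_count_nonneg: "expected_count Q n D \<ge> 0"
  unfolding expected_count_eq by (intro sum_nonneg block_weight_nonneg)

lemma expected_count_le: "expected_count Q n D \<le> real n"
  using sum_expected_count_le[of "{D}" "length D" Q n] by simp

text \<open>A position whose window is bounded by \<open>M\<close> contributes total weight 1, and
  every other position contributes a nonnegative amount.\<close>

lemma sum_expected_count_ge:
  assumes "basic_sequence Q"
  shows "real (card {j\<in>{1..n}. \<forall>i<Suc l. Q (j + i) \<le> M}) \<le>
    (\<Sum>D | set D \<subseteq> {..<M} \<and> length D = l. expected_count Q n D)"
proof -
  let ?F = "{D. set D \<subseteq> {..<M} \<and> length D = l}"
  let ?G = "{j\<in>{1..n}. \<forall>i<Suc l. Q (j + i) \<le> M}"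
  have "(\<Sum>D\<in>?F. block_weight D (window Q l j)) = 1" if "j \<in> ?G" for j
  proof -
    have "0 < w \<and> w \<le> M" if "w \<in> set (window Q l j)" for w
    proof -
      from that obtain i where i: "i < l" "w = Q (j + i)"
        by (auto simp: window_def)
      moreover have "Q (j + i) \<ge> 2"
        using assms \<open>j \<in> ?G\<close> by (simp add: basic_sequence_def)
      ultimately show ?thesis
        using \<open>j \<in> ?G\<close> by simp
    qed
    from sum_block_weight_eq_1[of "window Q l j" M, OF this] show ?thesis
      by (simp add: window_def)
  qed
  then have "real (card ?G) = (\<Sum>j\<in>?G. \<Sum>D\<in>?F. block_weight D (window Q l j))"
    by simp
  also have "\<dots> \<le> (\<Sum>j=1..n. \<Sum>D\<in>?F. block_weight D (window Q l j))"
    by (intro sum_mono2 sum_nonneg block_weight_nonneg) auto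
  also have "\<dots> = (\<Sum>D\<in>?F. expected_count Q n D)"
    by (subst sum_expected_count[where l = l]) auto
  finally show ?thesis .
qed

text \<open>A position carries only one digit block of length \<open>l\<close>, so different blocks
  are counted at disjoint sets of positions.\<close>

lemma sum_block_count:
  assumes "finite F" "\<And>D. D \<in> F \<Longrightarrow> length D = l"
  shows "(\<Sum>D\<in>F. block_count Q n D z) = card {i\<in>{1..n}. window (cantor_digit Q z) l (Suc i) \<in> F}"
proof -
  have "(\<Sum>D\<in>F. block_count Q n D z) =
      (\<Sum>D\<in>F. card {i\<in>{1..n}. window (cantor_digit Q z) l (Suc i) = D})"
    by (intro sum.cong) (simp_all add: block_count_eq assms)
  also have "\<dots> = card (\<Union>D\<in>F. {i\<in>{1..n}. window (cantor_digit Q z) l (Suc i) = D})"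
    using assms(1) by (intro card_UN_disjoint[symmetric]) auto
  also have "(\<Union>D\<in>F. {i\<in>{1..n}. window (cantor_digit Q z) l (Suc i) = D}) =
      {i\<in>{1..n}. window (cantor_digit Q z) l (Suc i) \<in> F}"
    by auto
  finally show ?thesis .
qed

lemma sum_block_count_le:
  assumes "finite F" "\<And>D. D \<in> F \<Longrightarrow> length D = l"
  shows "(\<Sum>D\<in>F. block_count Q n D z) \<le> n"
proof -
  have "card {i\<in>{1..n}. window (cantor_digit Q z) l (Suc i) \<in> F} \<le> card {1..n}"
    by (rule card_mono) auto
  then show ?thesis
    by (simp add: sum_block_count[OF assms])
qed

text \<open>
  Block counts start one position later than expected counts; windows of length \<open>Suc l\<close>, here
  and in \<open>sum_expected_count_ge\<close>, cover both conventions.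
\<close>

lemma sum_block_count_ge:
  assumes "basic_sequence Q" "z \<in> {0..<1}"
  shows "card {j\<in>{1..n}. \<forall>i<Suc l. Q (j + i) \<le> M} \<le>
    (\<Sum>D | set D \<subseteq> {..<M} \<and> length D = l. block_count Q n D z)"
proof -
  have "window (cantor_digit Q z) l (Suc j) \<in> {D. set D \<subseteq> {..<M} \<and> length D = l}"
    if "\<forall>i<Suc l. Q (j + i) \<le> M" for j
  proof -
    \<comment> \<open>The digit at \<open>Suc j + i\<close> is below the term of \<open>Q\<close> at
      \<open>j + Suc i\<close>, which is the shift that the extra window position covers.\<close>
    have "cantor_digit Q z (Suc j + i) < M" if "i < l" for i
      using cantor_digit_less[OF assms, of "Suc j + i"] \<open>\<forall>i<Suc l. Q (j + i) \<le> M\<close>[rule_format, of "Suc i"] that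
      by simp
    then show ?thesis
      by (auto simp: window_def)
  qed
  then have "card {j\<in>{1..n}. \<forall>i<Suc l. Q (j + i) \<le> M} \<le>
      card {j\<in>{1..n}. window (cantor_digit Q z) l (Suc j) \<in> {D. set D \<subseteq> {..<M} \<and> length D = l}}"
    by (intro card_mono) (simp, blast)
  also have "\<dots> = (\<Sum>D | set D \<subseteq> {..<M} \<and> length D = l. block_count Q n D z)"
    by (rule sum_block_count[symmetric, OF finite_bounded_blocks]) simp
  finally show ?thesis .
qed

text \<open>Digits lie strictly below the terms of \<open>Q\<close>, so an occurrence of
  \<open>D\<close> would give it positive weight at that position.\<close>

lemma block_count_eq_0:
  assumes "basic_sequence Q" "z \<in> {0..<1}"
    and "\<And>j. j \<ge> 1 \<Longrightarrow> block_weight D (window Q (length D) j) = 0"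
  shows "block_count Q n D z = 0"
proof -
  have "window (cantor_digit Q z) (length D) (Suc i) \<noteq> D" for i
  proof
    assume *: "window (cantor_digit Q z) (length D) (Suc i) = D"
    have "list_all2 (<) (window (cantor_digit Q z) (length D) (Suc i)) (window Q (length D) (Suc i))"
      by (simp add: list_all2_conv_all_nth window_def cantor_digit_less[OF assms(1,2)])
    then have "list_all2 (<) D (window Q (length D) (Suc i))"
      by (simp only: *)
    moreover have "prod_list (window Q (length D) (Suc i)) \<noteq> 0"
      using basic_sequence_Suc_ge_2[OF assms(1)]
      by (auto simp: prod_list_zero_iff window_def) (metis not_numeral_le_zero)
    ultimately show False
      using assms(3)[of "Suc i"] by (simp add: block_weight_def)
  qed
  then show ?thesis
    by (simp add: block_count_eq)
qed

section \<open>Ratio normality implies normality\<close>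

lemma ratio_normal_imp_block_normal:
  assumes Q: "basic_sequence Q" and dyn: "dynamically_generated TYPE('a) Q"
    and z: "z \<in> ratio_normal_numbers Q"
    and D: "D \<noteq> []" "filterlim (\<lambda>n. expected_count Q n D) at_top sequentially"
  shows "(\<lambda>n. real (block_count Q n D z) / expected_count Q n D) \<longlonglongrightarrow> 1"
proof -
  \<comment> \<open>The inverse of the sequence in question, which is 0 as long as \<open>D\<close>
    has not occurred since \<open>inverse 0 = 0\<close>. Inverting twice is exact in every case, so
    the limit 1 transfers back at the end.\<close>
  let ?b = "\<lambda>n. inverse (real (block_count Q n D z) / expected_count Q n D)"
  have z01: "z \<in> {0..<1}"
    using z by (simp add: ratio_normal_numbers_def)
  have null: "(\<lambda>n. real (block_count Q n E z) / real n * ?b n - expected_count Q n E / real n) \<longlonglongrightarrow> 0"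
    if E: "length E = length D" for E
  proof -
    consider "filterlim (\<lambda>n. expected_count Q n E) at_top sequentially"
      | "\<And>j. j \<ge> 1 \<Longrightarrow> block_weight E (window Q (length E) j) = 0"
      using dynamically_generated_window_dichotomy[OF dyn, of "block_weight E" 1 "length E"]
      by (auto simp: expected_count_eq block_weight_nonneg block_weight_le_1)
    then show ?thesis
    proof cases
      case 1
      let ?r = "\<lambda>n. (real (block_count Q n E z) / expected_count Q n E) /
        (real (block_count Q n D z) / expected_count Q n D)"
      have "filterlim (\<lambda>n. min (expected_count Q n E) (expected_count Q n D)) at_top sequentially"
        using 1 D(2) unfolding filterlim_at_top min.bounded_iff eventually_conj_iff by blast
      then have "?r \<longlonglongrightarrow> 1"
        using z E D(1) unfolding ratio_normal_numbers_def
        by (auto simp: Suc_le_eq)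
      then have lim: "(\<lambda>n. \<bar>?r n - 1\<bar>) \<longlonglongrightarrow> 0"
        by (simp add: LIM_zero tendsto_rabs_zero)
      have "\<forall>\<^sub>F n in sequentially. expected_count Q n E > 0"
        using 1 by (simp add: filterlim_at_top_dense)
      then have "\<forall>\<^sub>F n in sequentially.
          norm (real (block_count Q n E z) / real n * ?b n - expected_count Q n E / real n) \<le> \<bar>?r n - 1\<bar>"
      proof eventually_elim
        case (elim n)
        \<comment> \<open>The error is \<open>?r n - 1\<close> scaled by
          \<open>expected_count Q n E / real n\<close>, a factor that lies between 0 and 1.\<close>
        have "real (block_count Q n E z) / real n * ?b n - expected_count Q n E / real n =
            expected_count Q n E / real n * (?r n - 1)"
          using elim by (simp add: divide_inverse algebra_simps)
        also have "norm \<dots> = expected_count Q n E / real n * \<bar>?r n - 1\<bar>"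
          using elim by (simp only: real_norm_def abs_mult abs_divide abs_of_pos abs_of_nat)
        also have "\<dots> \<le> 1 * \<bar>?r n - 1\<bar>"
        proof (rule mult_right_mono)
          show "expected_count Q n E / real n \<le> 1"
            using expected_count_le[of Q n E] by (cases "n = 0") (simp_all add: divide_le_eq_1)
        qed simp
        finally show ?case
          by (simp only: mult_1)
      qed
      then show ?thesis
        using lim by (rule Lim_null_comparison)
    next
      case 2
      \<comment> \<open>A block of weight 0 everywhere has both counts equal to 0.\<close>
      then show ?thesis
        by (simp add: block_count_eq_0[OF Q z01 2] expected_count_eq)
    qed
  qed
  have "?b \<longlonglongrightarrow> 1"
  proof (rule tendstoI)
    fix e :: real
    assume "e > 0"
    \<comment> \<open>The bound \<open>1 / 2\<close> gives
      \<open>1 + \<epsilon> \<le> (1 - \<epsilon>) * (1 + 4 * \<epsilon>)\<close>, and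
      \<open>e / 4\<close> turns the resulting \<open>1 + 4 * \<epsilon>\<close> into at most
      \<open>1 + e\<close>.\<close>
    define \<epsilon> where "\<epsilon> = min (1 / 2) (e / 4)"
    have \<epsilon>: "\<epsilon> > 0" "\<epsilon> \<le> 1 / 2" "4 * \<epsilon> \<le> e"
      using \<open>e > 0\<close> by (auto simp: \<epsilon>_def)
    from dynamically_generated_windows_bounded[OF dyn \<epsilon>(1), of "Suc (length D)"]
    obtain M where M: "\<forall>\<^sub>F n in sequentially.
        (1 - \<epsilon>) * real n \<le> real (card {j\<in>{1..n}. \<forall>i<Suc (length D). Q (j + i) \<le> M})"
      by blast
    define F where "F = {E. set E \<subseteq> {..<M} \<and> length E = length D}"
    have F: "finite F" "\<And>E. E \<in> F \<Longrightarrow> length E = length D"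
      using finite_bounded_blocks by (auto simp: F_def)
    let ?A = "\<lambda>n. real (\<Sum>E\<in>F. block_count Q n E z) / real n"
    let ?B = "\<lambda>n. (\<Sum>E\<in>F. expected_count Q n E) / real n"
    have "(\<lambda>n. \<Sum>E\<in>F. real (block_count Q n E z) / real n * ?b n - expected_count Q n E / real n)
        \<longlonglongrightarrow> (\<Sum>E\<in>F. 0)"
      by (intro tendsto_sum null F)
    \<comment> \<open>The factor \<open>?b n\<close> does not depend on \<open>E\<close>, so it
      comes out of the finite sum.\<close>
    then have "(\<lambda>n. ?A n * ?b n - ?B n) \<longlonglongrightarrow> 0"
      by (simp add: sum_subtractf sum_distrib_right[symmetric] sum_divide_distrib[symmetric] del: inverse_divide)
    then have "\<forall>\<^sub>F n in sequentially. \<bar>?A n * ?b n - ?B n\<bar> < \<epsilon>"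
      using tendstoD[OF _ \<epsilon>(1)] by fastforce
    then show "\<forall>\<^sub>F n in sequentially. dist (?b n) 1 < e"
      using M eventually_gt_at_top[of 0]
    proof eventually_elim
      case (elim n)
      have bounds: "1 - \<epsilon> \<le> ?A n" "?A n \<le> 1" "1 - \<epsilon> \<le> ?B n" "?B n \<le> 1"
        using elim sum_block_count_ge[OF Q z01, of n "length D" M] sum_block_count_le[OF F, of Q n z]
          sum_expected_count_ge[OF Q, of n "length D" M] sum_expected_count_le[OF F, of Q n]
        unfolding F_def[symmetric] by (simp_all add: pos_le_divide_eq pos_divide_le_eq flip: of_nat_sum)
      have b: "?b n \<ge> 0"
        by (simp add: expected_count_nonneg)
      \<comment> \<open>\<open>?A n * ?b n\<close> is within \<open>\<epsilon>\<close> of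
        \<open>?B n\<close>, which lies in \<open>[1 - \<epsilon>, 1]\<close>. Next
        \<open>?A n \<le> 1\<close> bounds \<open>?b n\<close> from below, and
        \<open>1 - \<epsilon> \<le> ?A n\<close> bounds it from above.\<close>
      have AB: "?A n * ?b n < 1 + \<epsilon>" "?A n * ?b n > 1 - 2 * \<epsilon>"
        using elim(1) bounds by linarith+
      have "?A n * ?b n \<le> 1 * ?b n"
        by (intro mult_right_mono bounds b)
      then have lower: "?b n > 1 - e"
        using AB(2) \<epsilon> by linarith
      have "(1 - \<epsilon>) * ?b n \<le> ?A n * ?b n"
        by (intro mult_right_mono bounds b)
      also have "\<dots> < 1 + \<epsilon>"
        by (rule AB)
      also have "\<dots> \<le> (1 - \<epsilon>) * (1 + 4 * \<epsilon>)"
        using mult_left_mono[OF \<epsilon>(2), of \<epsilon>] \<epsilon>(1) by (simp add: algebra_simps)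
      finally have "?b n < 1 + 4 * \<epsilon>"
        by (rule mult_left_less_imp_less) (use \<epsilon> in simp)
      then show ?case
        using lower \<epsilon> by (simp only: dist_real_def abs_less_iff) linarith
    qed
  qed
  from tendsto_inverse[OF this] show ?thesis
    by simp
qed

section \<open>The two inclusions between normal and ratio normal numbers\<close>

theorem theorem6p2:
  fixes Q :: "nat \<Rightarrow> nat"
  assumes "basic_sequence Q"
    and "dynamically_generated TYPE('a) Q"
  shows "ratio_normal_numbers Q = normal_numbers Q"
proof
  show "ratio_normal_numbers Q \<subseteq> normal_numbers Q"
  proof
    fix z
    assume z: "z \<in> ratio_normal_numbers Q"
    then have "z \<in> {0..<1}"
      by (simp add: ratio_normal_numbers_def)
    then show "z \<in> normal_numbers Q"
      unfolding normal_numbers_def using ratio_normal_imp_block_normal[OF assms z] by blast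
  qed
next
  show "normal_numbers Q \<subseteq> ratio_normal_numbers Q"
  proof
    fix z
    assume z: "z \<in> normal_numbers Q"
    \<comment> \<open>Both expected counts dominate their minimum, so normality applies to each
      block and the quotient of the two limits is 1.\<close>
    have "(\<lambda>n. (real (block_count Q n D1 z) / expected_count Q n D1) /
        (real (block_count Q n D2 z) / expected_count Q n D2)) \<longlonglongrightarrow> 1"
      if "length D1 \<ge> 1" "length D2 = length D1"
        and lim: "filterlim (\<lambda>n. min (expected_count Q n D1) (expected_count Q n D2)) at_top sequentially"
      for D1 D2
    proof -
      have "filterlim (\<lambda>n. expected_count Q n D1) at_top sequentially"
        "filterlim (\<lambda>n. expected_count Q n D2) at_top sequentially"
        by (rule filterlim_at_top_mono[OF lim], simp)+
      moreover have "D1 \<noteq> []" "D2 \<noteq> []"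
        using that by auto
      ultimately have "(\<lambda>n. real (block_count Q n D1 z) / expected_count Q n D1) \<longlonglongrightarrow> 1"
        "(\<lambda>n. real (block_count Q n D2 z) / expected_count Q n D2) \<longlonglongrightarrow> 1"
        using z unfolding normal_numbers_def by blast+
      from tendsto_divide[OF this] show ?thesis
        by simp
    qed
    then show "z \<in> ratio_normal_numbers Q"
      using z by (auto simp: ratio_normal_numbers_def normal_numbers_def)
  qed
qed

end
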